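(* Let $M$ be an atomic Puiseux monoid. Then the following conditions are equivalent. (1) $\mathcal{A}(M)$ is somewhere dense in $\mathbb{R}_{\ge 0}$. (2) Each generating set of $M$ is somewhere dense in $\mathbb{R}_{\ge 0}$. If condition (1) or condition (2) holds, then $M$ is a somewhere dense Puiseux monoid.
   Context: A Puiseux monoid is an additive submonoid of $(\mathbb{Q}_{\ge 0},+)$. An atom of a Puiseux monoid $M$ is an element $a\in M\setminus\{0\}$ such that whenever $a=u+v$ with $u,v\in M$, either $u=0$ or $v=0$; $\mathcal{A}(M)$ denotes the set of atoms of $M$. A subset $S\subseteq M$ is a generating set of $M$ if no proper submonoid of $M$ contains $S$. $M$ is atomic if $\mathcal{A}(M)$ is a generating set of $M$. For $A,B\subseteq\mathbb{R}$, $A$ is dense in $B$ if $A\cap B$ is a dense subset of $B$ with the Euclidean subspace topology. A subset of $\mathbb{R}_{\ge 0}$ (in particular, a Puiseux monoid) is somewhere dense if there exists a nonempty open interval $(r,s)\subseteq\mathbb{R}_{\ge 0}$ such that it is dense in $(r,s)$. *)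

theory Defs
  imports "HOL-Analysis.Analysis"
begin

text \<open>
  Rational numbers are taken inside the reals (\<^term>\<open>\<rat> :: real set\<close>), so that the
  algebraic notions and the Euclidean topology live on the same type.
\<close>

definition add_submonoid :: "real set \<Rightarrow> real set \<Rightarrow> bool" where
  "add_submonoid N M \<longleftrightarrow> N \<subseteq> M \<and> 0 \<in> N \<and> (\<forall>x\<in>N. \<forall>y\<in>N. x + y \<in> N)"

definition puiseux_monoid :: "real set \<Rightarrow> bool" where
  "puiseux_monoid M \<longleftrightarrow> add_submonoid M (\<rat> \<inter> {0..})"

definition atoms :: "real set \<Rightarrow> real set" where
  "atoms M = {a \<in> M - {0}. \<forall>u\<in>M. \<forall>v\<in>M. a = u + v \<longrightarrow> u = 0 \<or> v = 0}"

definition generating_set :: "real set \<Rightarrow> real set \<Rightarrow> bool" where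
  "generating_set M S \<longleftrightarrow> S \<subseteq> M \<and> \<not> (\<exists>N. add_submonoid N M \<and> N \<noteq> M \<and> S \<subseteq> N)"

definition atomic_monoid :: "real set \<Rightarrow> bool" where
  "atomic_monoid M \<longleftrightarrow> generating_set M (atoms M)"

text \<open>
  The set \<open>A\<close> need not be contained in \<open>B\<close>; only \<open>A \<inter> B\<close> is required to be dense in \<open>B\<close>.
\<close>

definition dense_in :: "real set \<Rightarrow> real set \<Rightarrow> bool" where
  "dense_in A B \<longleftrightarrow> top_of_set B closure_of (A \<inter> B) = B"

text \<open>Intended for subsets of the nonnegative reals.\<close>

definition somewhere_dense :: "real set \<Rightarrow> bool" where
  "somewhere_dense A \<longleftrightarrow> (\<exists>r s. r < s \<and> {r<..<s} \<subseteq> {0..} \<and> dense_in A {r<..<s})"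

end

theory Submission
  imports Defs
begin

text \<open>Deleting an atom from \<open>M\<close> leaves a proper submonoid, so every generating
  set contains all atoms (\<open>atoms_subset_generating_set\<close>). Atomicity says that the atoms
  themselves generate, so \<open>atoms M\<close> is the least generating set. Since being somewhere
  dense passes to supersets (\<open>somewhere_dense_mono\<close>), it holds for every generating
  set, and for \<open>M\<close>, once it holds for the least one.\<close>

lemma dense_in_mono:
  assumes "dense_in A C" "A \<subseteq> B"
  shows "dense_in B C"
proof -
  have "top_of_set C closure_of (A \<inter> C) \<subseteq> top_of_set C closure_of (B \<inter> C)"
    using assms(2) by (intro closure_of_mono) auto
  moreover have "top_of_set C closure_of (B \<inter> C) \<subseteq> C"
    using closure_of_subset_topspace[of "top_of_set C"] by simp
  ultimately show ?thesis
    using assms(1) unfolding dense_in_def by auto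
qed

lemma somewhere_dense_mono:
  "somewhere_dense A \<Longrightarrow> A \<subseteq> B \<Longrightarrow> somewhere_dense B"
  unfolding somewhere_dense_def by (meson dense_in_mono)

text \<open>If \<open>x + y = a\<close> in \<open>M\<close>, one summand is 0 and the other is
  therefore \<open>a\<close> itself; so elements different from \<open>a\<close> never add up to
  \<open>a\<close>.\<close>

lemma add_submonoid_diff_atom:
  assumes "puiseux_monoid M" "a \<in> atoms M"
  shows "add_submonoid (M - {a}) M"
  unfolding add_submonoid_def
proof (intro conjI ballI)
  have closed: "0 \<in> M" "\<And>x y. x \<in> M \<Longrightarrow> y \<in> M \<Longrightarrow> x + y \<in> M"
    using assms(1) unfolding puiseux_monoid_def add_submonoid_def by auto
  have a: "a \<noteq> 0" "\<And>u v. u \<in> M \<Longrightarrow> v \<in> M \<Longrightarrow> a = u + v \<Longrightarrow> u = 0 \<or> v = 0"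
    using assms(2) unfolding atoms_def by auto
  show "M - {a} \<subseteq> M"
    by auto
  show "0 \<in> M - {a}"
    using closed(1) a(1) by auto
  fix x y assume xy: "x \<in> M - {a}" "y \<in> M - {a}"
  then have "x + y \<noteq> a"
    using a(2)[of x y] by auto
  then show "x + y \<in> M - {a}"
    using closed(2) xy by auto
qed

lemma atoms_subset_generating_set:
  assumes "puiseux_monoid M" "generating_set M S"
  shows "atoms M \<subseteq> S"
proof
  fix a assume a: "a \<in> atoms M"
  then have "M - {a} \<noteq> M"
    unfolding atoms_def by auto
  \<comment> \<open>Otherwise the proper submonoid \<open>M - {a}\<close> would contain the
    generating set.\<close>
  then have "\<not> S \<subseteq> M - {a}"
    using assms(2) add_submonoid_diff_atom[OF assms(1) a] unfolding generating_set_def by blast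
  then show "a \<in> S"
    using assms(2) unfolding generating_set_def by auto
qed

theorem proposition3p4:
  fixes M :: "real set"
  assumes "puiseux_monoid M" and "atomic_monoid M"
  shows "(somewhere_dense (atoms M) \<longleftrightarrow> (\<forall>S. generating_set M S \<longrightarrow> somewhere_dense S)) \<and>
    (somewhere_dense (atoms M) \<or> (\<forall>S. generating_set M S \<longrightarrow> somewhere_dense S) \<longrightarrow>
      somewhere_dense M)"
proof -
  have gen: "generating_set M (atoms M)"
    using assms(2) unfolding atomic_monoid_def .
  have equiv: "somewhere_dense (atoms M) \<longleftrightarrow> (\<forall>S. generating_set M S \<longrightarrow> somewhere_dense S)"
    \<comment> \<open>Atomicity enters only from right to left, through the instance
      \<open>S = atoms M\<close>; the other direction is monotonicity.\<close>
    using gen somewhere_dense_mono[OF _ atoms_subset_generating_set[OF assms(1)]] by auto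
  have "atoms M \<subseteq> M"
    unfolding atoms_def by auto
  then have "somewhere_dense M" if "somewhere_dense (atoms M)"
    using somewhere_dense_mono that by simp
  then show ?thesis
    using equiv by simp
qed

end
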